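(* Let $\epsilon>0$ and let $n\ge 2$ be an integer. For every integer $m\le n$ with $2m\ge n+1$, the control $n$ body problem in the real line $\mathbb{R}$ with separation by $\epsilon$ is solvable by constructing smooth vector fields $\vec f_1,\dots,\vec f_m$ on $\mathbb{R}^n$. Furthermore, these can be constructed so that, for each $\ell=1,\dots,m$, $\vec f_\ell$ depends only on $x_{\ell-1},x_\ell,x_{m+\ell-2}$ and $x_{m+\ell-1}$.
   Context: Smooth means $C^\infty$. A point $\mathbf{x}=(x_1,\dots,x_n)\in\mathbb{R}^n$, viewed as the positions of $n$ particles on the real line, is separated by $\epsilon$ if $x_j+\epsilon<x_{j+1}$ for each $j=1,\dots,n-1$. The control $n$ body problem in $\mathbb{R}$ with separation by $\epsilon$ is solved by smooth vector fields $\vec f_1,\dots,\vec f_m$ on $\mathbb{R}^n$ if the control-affine system $$\dot{\mathbf{x}}=\sum_{\ell=1}^m\vec f_\ell(\mathbf{x})\,u_\ell(t),$$ with controls $\mathbf{u}=(u_1,\dots,u_m)$ that are piecewise smooth real-valued functions of $t$ with finitely many discontinuities, satisfies: 1) (Collision-free) every solution whose initial point $\mathbf{x}(0)$ is separated by $\epsilon$ remains separated by $\epsilon$ for all $t\ge0$ at which it is defined, for all such controls; 2) (Controllability) for any $\mathbf{p}=(p_1,\dots,p_n)$ and $\mathbf{q}=(q_1,\dots,q_n)$ in $\mathbb{R}^n$ that are separated by $\epsilon$, there exist piecewise smooth real-valued functions $u_\ell(t)$, $\ell=1,\dots,m$, on some interval $0\le t\le T$ such that the system has a solution $\mathbf{x}(t)$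 on $[0,T]$ with $x_j(0)=p_j$ and $x_j(T)=q_j$ for each $j=1,\dots,n$. A vector field "depends only on" certain coordinates if all its coefficient functions with respect to $\partial/\partial x_1,\dots,\partial/\partial x_n$ depend only on those coordinates; in the list $x_{\ell-1},x_\ell,x_{m+\ell-2},x_{m+\ell-1}$, any symbol whose index is not in $\{1,\dots,n\}$ is omitted. *)

theory Defs
  imports "HOL-Analysis.Analysis"
begin

text \<open>Smoothness on the whole space. Taking derivatives in all fixed directions \<open>v\<close> amounts to
  taking all iterated partial derivatives.\<close>

fun times_cont_differentiable ::
    "nat \<Rightarrow> ('a::real_normed_vector \<Rightarrow> 'b::real_normed_vector) \<Rightarrow> bool" where
  "times_cont_differentiable 0 f \<longleftrightarrow> continuous_on UNIV f"
| "times_cont_differentiable (Suc k) f \<longleftrightarrow>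
     (\<forall>x. f differentiable (at x)) \<and>
     (\<forall>v. times_cont_differentiable k (\<lambda>x. frechet_derivative f (at x) v))"

definition smooth :: "('a::real_normed_vector \<Rightarrow> 'b::real_normed_vector) \<Rightarrow> bool" where
  "smooth f \<longleftrightarrow> (\<forall>k. times_cont_differentiable k f)"

text \<open>Away from a finite set \<open>S\<close> of break points the function is smooth, and each piece is smooth up
  to the ends of the piece that lie in \<open>J\<close>, i.e. all derivatives have finite one-sided limits
  there; this is expressed by extending the piece to a smooth function on the real line. The values
  at the break points, and at the ends of \<open>J\<close>, are arbitrary. If \<open>J\<close> is not compact, the
  extension is only required on its compact subintervals.\<close>

definition piecewise_smooth_on :: "real set \<Rightarrow> (real \<Rightarrow> real) \<Rightarrow> bool" where
  "piecewise_smooth_on J u \<longleftrightarrow>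
     (\<exists>S. finite S \<and>
        (\<forall>a b. a < b \<and> {a..b} \<subseteq> J \<and> {a<..<b} \<inter> S = {} \<longrightarrow>
           (\<exists>g. smooth g \<and> (\<forall>t\<in>{a<..<b}. u t = g t))))"

text \<open>As controls may jump, a solution is a continuous curve which satisfies the
  differential equation at all but finitely many times.\<close>

definition control_solution_on ::
    "real set \<Rightarrow> nat \<Rightarrow> (nat \<Rightarrow> real^'n \<Rightarrow> real^'n) \<Rightarrow> (nat \<Rightarrow> real \<Rightarrow> real) \<Rightarrow> (real \<Rightarrow> real^'n) \<Rightarrow> bool"
  where
  "control_solution_on J m f u x \<longleftrightarrow>
     continuous_on J x \<and>
     (\<exists>S. finite S \<and>
        (\<forall>t\<in>J - S. (x has_vector_derivative (\<Sum>l\<in>{1..m}. u l t *\<^sub>R f l (x t))) (at t within J)))"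

text \<open>The index type \<open>'n\<close> carries no order, so \<open>idx\<close> numbers the coordinates: if
  \<open>bij_betw idx {1..n} UNIV\<close>, then \<open>x $ idx j\<close> is the position \<open>x\<^sub>j\<close> of particle \<open>j\<close>.\<close>

definition separated_by :: "real \<Rightarrow> nat \<Rightarrow> (nat \<Rightarrow> 'n) \<Rightarrow> real^'n \<Rightarrow> bool" where
  "separated_by \<epsilon> n idx x \<longleftrightarrow> (\<forall>j\<in>{1..n-1}. x $ idx j + \<epsilon> < x $ idx (j+1))"

definition collision_free ::
    "real \<Rightarrow> nat \<Rightarrow> (nat \<Rightarrow> 'n::finite) \<Rightarrow> nat \<Rightarrow> (nat \<Rightarrow> real^'n \<Rightarrow> real^'n) \<Rightarrow> bool" where
  "collision_free \<epsilon> n idx m f \<longleftrightarrow>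
     (\<forall>J u x. is_interval J \<and> 0 \<in> J \<and> J \<subseteq> {0..} \<and>
        (\<forall>l\<in>{1..m}. piecewise_smooth_on J (u l)) \<and>
        control_solution_on J m f u x \<and> separated_by \<epsilon> n idx (x 0) \<longrightarrow>
        (\<forall>t\<in>J. separated_by \<epsilon> n idx (x t)))"

definition controllable ::
    "real \<Rightarrow> nat \<Rightarrow> (nat \<Rightarrow> 'n::finite) \<Rightarrow> nat \<Rightarrow> (nat \<Rightarrow> real^'n \<Rightarrow> real^'n) \<Rightarrow> bool" where
  "controllable \<epsilon> n idx m f \<longleftrightarrow>
     (\<forall>p q. separated_by \<epsilon> n idx p \<and> separated_by \<epsilon> n idx q \<longrightarrow>
        (\<exists>T>0. \<exists>u x. (\<forall>l\<in>{1..m}. piecewise_smooth_on {0..T} (u l)) \<and>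
           control_solution_on {0..T} m f u x \<and> x 0 = p \<and> x T = q))"

definition solves_control_n_body ::
    "real \<Rightarrow> nat \<Rightarrow> (nat \<Rightarrow> 'n::finite) \<Rightarrow> nat \<Rightarrow> (nat \<Rightarrow> real^'n \<Rightarrow> real^'n) \<Rightarrow> bool" where
  "solves_control_n_body \<epsilon> n idx m f \<longleftrightarrow>
     (\<forall>l\<in>{1..m}. smooth (f l)) \<and> collision_free \<epsilon> n idx m f \<and> controllable \<epsilon> n idx m f"

text \<open>Indices in \<open>K\<close> outside \<open>{1..n}\<close> are omitted.\<close>

definition depends_only_on ::
    "nat \<Rightarrow> (nat \<Rightarrow> 'n::finite) \<Rightarrow> nat set \<Rightarrow> (real^'n \<Rightarrow> real^'n) \<Rightarrow> bool" where
  "depends_only_on n idx K F \<longleftrightarrow>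
     (\<forall>x y. (\<forall>k\<in>K \<inter> {1..n}. x $ idx k = y $ idx k) \<longrightarrow> F x = F y)"

end

theory Submission
  imports Defs
begin

text \<open>Write \<open>g\<^sub>j = x\<^sub>j\<^sub>+\<^sub>1 - x\<^sub>j - \<epsilon>\<close> for the gaps and \<open>v\<^sub>k = \<partial>\<^sub>k + \<dots> + \<partial>\<^sub>n\<close>; moving along \<open>v\<^sub>k\<close> with \<open>k \<ge> 2\<close>
  changes the gap \<open>g\<^sub>k\<^sub>-\<^sub>1\<close> only, and \<open>v\<^sub>1\<close> translates all particles. Take \<open>f\<^sub>1 = v\<^sub>1\<close> and, for \<open>\<ell> \<ge> 2\<close>,
  \<open>f\<^sub>\<ell> = x\<^sub>\<ell>\<^sub>-\<^sub>1 g\<^sub>\<ell>\<^sub>-\<^sub>1 v\<^sub>\<ell> + (1 - x\<^sub>\<ell>\<^sub>-\<^sub>1) g\<^sub>m\<^sub>+\<^sub>\<ell>\<^sub>-\<^sub>2 v\<^sub>m\<^sub>+\<^sub>\<ell>\<^sub>-\<^sub>1\<close>. Along every solution each gap satisfies a linear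
  equation \<open>g' = h(t) g\<close> with locally bounded \<open>h\<close>, so it stays positive. Conversely, after a
  translation to \<open>x\<^sub>\<ell>\<^sub>-\<^sub>1 = 1\<close> (respectively \<open>x\<^sub>\<ell>\<^sub>-\<^sub>1 = 0\<close>) the flow of \<open>f\<^sub>\<ell>\<close> fixes \<open>x\<^sub>\<ell>\<^sub>-\<^sub>1\<close> and rescales
  \<open>g\<^sub>\<ell>\<^sub>-\<^sub>1\<close> (respectively \<open>g\<^sub>m\<^sub>+\<^sub>\<ell>\<^sub>-\<^sub>2\<close>) alone. As \<open>n - 1 \<le> 2m - 2\<close>, every gap is of one of these two
  kinds, so all gaps can be adjusted one after the other, and a final translation adjusts \<open>x\<^sub>1\<close>.\<close>

section \<open>Smooth functions\<close>

lemma times_cont_differentiable_const: "times_cont_differentiable k (\<lambda>x. c)"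
  by (induction k arbitrary: c) auto

lemma smooth_const: "smooth (\<lambda>x. c)"
  by (simp add: smooth_def times_cont_differentiable_const)

text \<open>The derivative is \<open>f\<close> at every point, so directional derivatives are
  constant. This covers the coordinate functions.\<close>

lemma smooth_bounded_linear:
  assumes "bounded_linear f"
  shows "smooth f"
proof -
  have "frechet_derivative f (at x) = f" for x
    using frechet_derivative_at[OF bounded_linear_imp_has_derivative[OF assms]] by metis
  then have "times_cont_differentiable k f" for k
    using assms
    by (cases k) (auto simp: times_cont_differentiable_const linear_continuous_on
        bounded_linear_imp_differentiable)
  then show ?thesis by (simp add: smooth_def)
qed

text \<open>Needed in the product rule, where one factor of each summand stays
  undifferentiated.\<close>

lemma times_cont_differentiable_Suc_imp:
  "times_cont_differentiable (Suc k) f \<Longrightarrow> times_cont_differentiable k f"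
proof (induction k arbitrary: f)
  case 0
  then show ?case
    by (auto simp: continuous_on_eq_continuous_at intro: differentiable_imp_continuous_within)
next
  case (Suc k)
  then show ?case
    by (metis times_cont_differentiable.simps(2))
qed

lemma times_cont_differentiable_add:
  assumes "times_cont_differentiable k f" "times_cont_differentiable k g"
  shows "times_cont_differentiable k (\<lambda>x. f x + g x)"
  using assms
proof (induction k arbitrary: f g)
  case 0
  then show ?case by (auto intro: continuous_on_add)
next
  case (Suc k)
  have "((\<lambda>x. f x + g x) has_derivative
      (\<lambda>v. frechet_derivative f (at x) v + frechet_derivative g (at x) v)) (at x)" for x
    using Suc.prems by (intro has_derivative_add) (auto simp: frechet_derivative_works[symmetric])
  then have "frechet_derivative (\<lambda>x. f x + g x) (at x)
      = (\<lambda>v. frechet_derivative f (at x) v + frechet_derivative g (at x) v)" for x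
    using frechet_derivative_at by metis
  with Suc show ?case by (auto intro: differentiable_add)
qed

text \<open>The product rule writes each directional derivative as a sum of two products of order
  \<open>k\<close>, so induction applies.\<close>

lemma (in bounded_bilinear) times_cont_differentiable:
  assumes "times_cont_differentiable k f" "times_cont_differentiable k g"
  shows "times_cont_differentiable k (\<lambda>x. prod (f x) (g x))"
  using assms
proof (induction k arbitrary: f g)
  case 0
  then show ?case by (auto intro: continuous_on)
next
  case (Suc k)
  have der: "((\<lambda>x. prod (f x) (g x)) has_derivative
      (\<lambda>v. prod (f x) (frechet_derivative g (at x) v) + prod (frechet_derivative f (at x) v) (g x)))
      (at x)" for x
    using Suc.prems by (intro FDERIV) (auto simp: frechet_derivative_works[symmetric])
  have "frechet_derivative (\<lambda>x. prod (f x) (g x)) (at x) =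
      (\<lambda>v. prod (f x) (frechet_derivative g (at x) v) + prod (frechet_derivative f (at x) v) (g x))" for x
    using frechet_derivative_at[OF der] by metis
  moreover have "times_cont_differentiable k f" "times_cont_differentiable k g"
    using Suc.prems times_cont_differentiable_Suc_imp by blast+
  moreover have "(\<lambda>x. prod (f x) (g x)) differentiable (at x)" for x
    using der by (rule differentiableI)
  ultimately show ?case
    using Suc by (auto intro!: times_cont_differentiable_add)
qed

lemma smooth_add: "smooth f \<Longrightarrow> smooth g \<Longrightarrow> smooth (\<lambda>x. f x + g x)"
  by (simp add: smooth_def times_cont_differentiable_add)

lemma smooth_scaleR: "smooth f \<Longrightarrow> smooth g \<Longrightarrow> smooth (\<lambda>x. f x *\<^sub>R g x)"
  by (simp add: smooth_def bounded_bilinear.times_cont_differentiable[OF bounded_bilinear_scaleR])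

lemma smooth_mult:
  fixes f g :: "'a::real_normed_vector \<Rightarrow> 'b::real_normed_algebra"
  shows "smooth f \<Longrightarrow> smooth g \<Longrightarrow> smooth (\<lambda>x. f x * g x)"
  by (simp add: smooth_def bounded_bilinear.times_cont_differentiable[OF bounded_bilinear_mult])

lemma smooth_diff:
  assumes "smooth f" "smooth g"
  shows "smooth (\<lambda>x. f x - g x)"
  using smooth_add[OF assms(1) smooth_scaleR[OF smooth_const[of "-1"] assms(2)]] by simp

section \<open>Piecewise smooth controls\<close>

lemma piecewise_smooth_on_const: "piecewise_smooth_on J (\<lambda>t. c)"
  unfolding piecewise_smooth_on_def using smooth_const by blast

text \<open>Induction on the number of break points inside: a break-free piece extends continuously
  to the compact closure; otherwise the interval is cut at a break point \<open>c\<close>, and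
  \<open>u c\<close> adds a single value.\<close>

lemma piecewise_smooth_on_bounded:
  assumes "piecewise_smooth_on J u" "{a..b} \<subseteq> J"
  shows "bounded (u ` {a<..<b})"
proof -
  obtain S where S: "finite S"
    and ext: "\<And>a b. a < b \<Longrightarrow> {a..b} \<subseteq> J \<Longrightarrow> {a<..<b} \<inter> S = {} \<Longrightarrow>
      \<exists>g. smooth g \<and> (\<forall>t\<in>{a<..<b}. u t = g t)"
    using assms(1) unfolding piecewise_smooth_on_def by blast
  show ?thesis
    using assms(2)
  proof (induction "card ({a<..<b} \<inter> S)" arbitrary: a b rule: less_induct)
    case less
    consider "b \<le> a" | "a < b" "{a<..<b} \<inter> S = {}" | c where "c \<in> {a<..<b} \<inter> S"
      by fastforce
    then show ?case
    proof cases
      case 1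
      then show ?thesis by simp
    next
      case 2
      then obtain g where g: "smooth g" "\<forall>t\<in>{a<..<b}. u t = g t"
        using ext less.prems by blast
      from g(1) have "times_cont_differentiable 0 g" by (simp only: smooth_def)
      then have "continuous_on {a..b} g"
        using continuous_on_subset by auto
      then have "bounded (g ` {a..b})"
        by (simp add: compact_continuous_image compact_imp_bounded)
      moreover have "u ` {a<..<b} \<subseteq> g ` {a..b}"
        using g(2) by force
      ultimately show ?thesis by (rule bounded_subset)
    next
      case 3
      have "{a<..<c} \<inter> S \<subset> {a<..<b} \<inter> S" "{c<..<b} \<inter> S \<subset> {a<..<b} \<inter> S"
        using 3 by auto
      then have "card ({a<..<c} \<inter> S) < card ({a<..<b} \<inter> S)"
        "card ({c<..<b} \<inter> S) < card ({a<..<b} \<inter> S)"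
        using S by (auto intro: psubset_card_mono)
      moreover have "{a..c} \<subseteq> J" "{c..b} \<subseteq> J"
        using 3 less.prems by auto
      ultimately have "bounded (u ` {a<..<c})" "bounded (u ` {c<..<b})"
        using less.hyps by blast+
      then have "bounded (u ` {a<..<c} \<union> {u c} \<union> u ` {c<..<b})" by simp
      moreover have "u ` {a<..<b} \<subseteq> u ` {a<..<c} \<union> {u c} \<union> u ` {c<..<b}"
      proof
        fix y assume "y \<in> u ` {a<..<b}"
        then obtain t where "y = u t" "a < t" "t < b" by auto
        then show "y \<in> u ` {a<..<c} \<union> {u c} \<union> u ` {c<..<b}"
          by (cases t c rule: linorder_cases) auto
      qed
      ultimately show ?thesis by (rule bounded_subset)
    qed
  qed
qed

section \<open>Concatenation of controls and of trajectories\<close>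

lemma piecewise_smooth_on_concat:
  assumes "piecewise_smooth_on {a..b} u" "piecewise_smooth_on {b..c} v"
  shows "piecewise_smooth_on {a..c} (\<lambda>t. if t \<le> b then u t else v t)"
proof -
  obtain S where S: "finite S" "\<And>r s. r < s \<Longrightarrow> {r..s} \<subseteq> {a..b} \<Longrightarrow> {r<..<s} \<inter> S = {} \<Longrightarrow>
      \<exists>g. smooth g \<and> (\<forall>t\<in>{r<..<s}. u t = g t)"
    using assms(1) unfolding piecewise_smooth_on_def by blast
  obtain S' where S': "finite S'" "\<And>r s. r < s \<Longrightarrow> {r..s} \<subseteq> {b..c} \<Longrightarrow> {r<..<s} \<inter> S' = {} \<Longrightarrow>
      \<exists>g. smooth g \<and> (\<forall>t\<in>{r<..<s}. v t = g t)"
    using assms(2) unfolding piecewise_smooth_on_def by blast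
  have "\<exists>g. smooth g \<and> (\<forall>t\<in>{r<..<s}. (if t \<le> b then u t else v t) = g t)"
    if "r < s" "{r..s} \<subseteq> {a..c}" and disj: "{r<..<s} \<inter> insert b (S \<union> S') = {}" for r s
  proof (cases "s \<le> b")
    case True
    then have "{r..s} \<subseteq> {a..b}" "{r<..<s} \<inter> S = {}" using that by auto
    then obtain g where "smooth g" "\<forall>t\<in>{r<..<s}. u t = g t" using S(2) \<open>r < s\<close> by blast
    then show ?thesis using True by (intro exI[of _ g]) auto
  next
    case False
    \<comment> \<open>\<open>b\<close> is counted as a break point, so a break-free interval cannot
      straddle it.\<close>
    then have "b \<le> r" using disj by force
    then have "{r..s} \<subseteq> {b..c}" "{r<..<s} \<inter> S' = {}" using that by auto
    then obtain g where "smooth g" "\<forall>t\<in>{r<..<s}. v t = g t" using S'(2) \<open>r < s\<close> by blast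
    then show ?thesis using \<open>b \<le> r\<close> by (intro exI[of _ g]) auto
  qed
  then show ?thesis
    unfolding piecewise_smooth_on_def using S(1) S'(1)
    by (intro exI[of _ "insert b (S \<union> S')"]) auto
qed

lemma control_solution_on_concat:
  assumes "a \<le> b" "b \<le> c"
    and "control_solution_on {a..b} m f u x" "control_solution_on {b..c} m f v y" "x b = y b"
  shows "control_solution_on {a..c} m f
    (\<lambda>l t. if t \<le> b then u l t else v l t) (\<lambda>t. if t \<le> b then x t else y t)"
    (is "control_solution_on _ _ _ ?w ?z")
proof -
  obtain S where S: "finite S" "\<And>t. t \<in> {a..b} - S \<Longrightarrow>
      (x has_vector_derivative (\<Sum>l\<in>{1..m}. u l t *\<^sub>R f l (x t))) (at t within {a..b})"
    using assms(3) unfolding control_solution_on_def by blast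
  obtain S' where S': "finite S'" "\<And>t. t \<in> {b..c} - S' \<Longrightarrow>
      (y has_vector_derivative (\<Sum>l\<in>{1..m}. v l t *\<^sub>R f l (y t))) (at t within {b..c})"
    using assms(4) unfolding control_solution_on_def by blast
  have cont: "continuous_on {a..c} ?z"
  proof -
    have "continuous_on ({a..b} \<union> {b..c}) ?z"
      using assms by (intro continuous_on_If) (auto simp: control_solution_on_def)
    then show ?thesis using assms by (simp add: ivl_disj_un_two_touch)
  qed
  have "(?z has_vector_derivative (\<Sum>l\<in>{1..m}. ?w l t *\<^sub>R f l (?z t))) (at t within {a..c})"
    if t: "t \<in> {a..c} - insert b (S \<union> S')" for t
  proof (cases "t < b")
    case True
    have "(x has_vector_derivative (\<Sum>l\<in>{1..m}. u l t *\<^sub>R f l (x t))) (at t within {a..b})"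
      using S(2) t True by auto
    also have "at t within {a..b} = at t within {a..c}"
      using True assms by (intro at_within_nhd[of _ "{..<b}"]) auto
    finally have "(?z has_vector_derivative (\<Sum>l\<in>{1..m}. u l t *\<^sub>R f l (x t))) (at t within {a..c})"
      by (rule has_vector_derivative_transform_within[where d = "b - t"])
        (use True t in \<open>auto simp: dist_real_def\<close>)
    then show ?thesis using True by simp
  next
    case False
    then have bt: "b < t" using t by auto
    have "(y has_vector_derivative (\<Sum>l\<in>{1..m}. v l t *\<^sub>R f l (y t))) (at t within {b..c})"
      using S'(2) t bt by auto
    also have "at t within {b..c} = at t within {a..c}"
      using bt assms by (intro at_within_nhd[of _ "{b<..}"]) auto
    finally have "(?z has_vector_derivative (\<Sum>l\<in>{1..m}. v l t *\<^sub>R f l (y t))) (at t within {a..c})"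
      by (rule has_vector_derivative_transform_within[where d = "t - b"])
        (use bt t in \<open>auto simp: dist_real_def\<close>)
    then show ?thesis using bt by simp
  qed
  then show ?thesis
    unfolding control_solution_on_def using cont S(1) S'(1)
    by (intro conjI exI[of _ "insert b (S \<union> S')"]) auto
qed

section \<open>Reachability\<close>

text \<open>The starting time is arbitrary, so that trajectories can be concatenated without shifting
  the time parameter of the controls.\<close>

definition reachable ::
    "nat \<Rightarrow> (nat \<Rightarrow> real^'n \<Rightarrow> real^'n) \<Rightarrow> real^'n \<Rightarrow> real^'n \<Rightarrow> bool" where
  "reachable m f p q \<longleftrightarrow>
     (\<forall>a. \<exists>b>a. \<exists>u x. (\<forall>l\<in>{1..m}. piecewise_smooth_on {a..b} (u l)) \<and>
        control_solution_on {a..b} m f u x \<and> x a = p \<and> x b = q)"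

lemma reachable_trans:
  assumes "reachable m f p q" "reachable m f q r"
  shows "reachable m f p r"
  unfolding reachable_def
proof
  fix a
  obtain b u x where 1: "a < b" "\<forall>l\<in>{1..m}. piecewise_smooth_on {a..b} (u l)"
      "control_solution_on {a..b} m f u x" "x a = p" "x b = q"
    using assms(1)[unfolded reachable_def, rule_format, of a] by (elim exE conjE)
  obtain c v y where 2: "b < c" "\<forall>l\<in>{1..m}. piecewise_smooth_on {b..c} (v l)"
      "control_solution_on {b..c} m f v y" "y b = q" "y c = r"
    using assms(2)[unfolded reachable_def, rule_format, of b] by (elim exE conjE)
  show "\<exists>b>a. \<exists>u x. (\<forall>l\<in>{1..m}. piecewise_smooth_on {a..b} (u l)) \<and>
        control_solution_on {a..b} m f u x \<and> x a = p \<and> x b = r"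
    using 1 2
    by (intro exI[of _ c] conjI exI[of _ "\<lambda>l t. if t \<le> b then u l t else v l t"]
        exI[of _ "\<lambda>t. if t \<le> b then x t else y t"])
      (auto intro: piecewise_smooth_on_concat control_solution_on_concat)
qed

text \<open>With control \<open>l\<close> held at \<open>c\<close> and all others at 0, the system
  on the line reduces to the scalar equation for \<open>s\<close> expressed by \<open>eq\<close>; it
  is followed for unit time.\<close>

lemma reachable_along_line:
  assumes l: "l \<in> {1..m}"
    and der: "\<And>t. (s has_real_derivative r t) (at t)"
    and eq: "\<And>t. r t *\<^sub>R v = c *\<^sub>R f l (p + s t *\<^sub>R v)"
  shows "reachable m f (p + s 0 *\<^sub>R v) (p + s 1 *\<^sub>R v)"
  unfolding reachable_def
proof
  fix a :: real
  let ?u = "\<lambda>k (t::real). if k = l then c else 0"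
  let ?x = "\<lambda>t. p + s (t - a) *\<^sub>R v"
  have "(?x has_vector_derivative (\<Sum>k\<in>{1..m}. ?u k t *\<^sub>R f k (?x t))) (at t within {a..a+1})" for t
  proof -
    have "(\<Sum>k\<in>{1..m}. ?u k t *\<^sub>R f k (?x t)) = (\<Sum>k\<in>{1..m}. if k = l then c *\<^sub>R f k (?x t) else 0)"
      by (rule sum.cong) auto
    also have "\<dots> = r (t - a) *\<^sub>R v"
      using l by (simp add: eq)
    finally have sum: "(\<Sum>k\<in>{1..m}. ?u k t *\<^sub>R f k (?x t)) = r (t - a) *\<^sub>R v" .
    have "((\<lambda>t. s (t - a)) has_real_derivative r (t - a)) (at t within {a..a+1})"
      by (rule DERIV_chain2[OF der, THEN DERIV_cong]) (auto intro!: derivative_eq_intros)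
    then have "(?x has_vector_derivative r (t - a) *\<^sub>R v) (at t within {a..a+1})"
      by (auto intro!: derivative_eq_intros)
    then show ?thesis by (simp only: sum)
  qed
  note sol = this
  then have "continuous_on {a..a+1} ?x"
    using has_vector_derivative_continuous continuous_on_eq_continuous_within by blast
  with sol have "control_solution_on {a..a+1} m f ?u ?x"
    unfolding control_solution_on_def by blast
  then show "\<exists>b>a. \<exists>u x. (\<forall>k\<in>{1..m}. piecewise_smooth_on {a..b} (u k)) \<and>
      control_solution_on {a..b} m f u x \<and> x a = p + s 0 *\<^sub>R v \<and> x b = p + s 1 *\<^sub>R v"
    by (intro exI[of _ "a + 1"] conjI exI[of _ ?u] exI[of _ ?x])
      (auto simp: piecewise_smooth_on_const)
qed

section \<open>Bounds for products and finite sums\<close>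

lemma bounded_image_mult:
  fixes f g :: "'a \<Rightarrow> real"
  assumes "bounded (f ` A)" "bounded (g ` A)"
  shows "bounded ((\<lambda>x. f x * g x) ` A)"
proof -
  obtain B C where "\<And>x. x \<in> A \<Longrightarrow> \<bar>f x\<bar> \<le> B" "\<And>x. x \<in> A \<Longrightarrow> \<bar>g x\<bar> \<le> C"
    using assms unfolding bounded_real by (metis imageI)
  then have "\<bar>f x * g x\<bar> \<le> B * C" if "x \<in> A" for x
    using that by (force simp: abs_mult intro: mult_mono')
  then show ?thesis unfolding bounded_real by blast
qed

lemma bounded_image_sum:
  fixes f :: "'i \<Rightarrow> 'a \<Rightarrow> 'b::real_normed_vector"
  assumes "\<And>i. i \<in> I \<Longrightarrow> bounded (f i ` A)"
  shows "bounded ((\<lambda>x. \<Sum>i\<in>I. f i x) ` A)"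
  using assms
proof (induction I rule: infinite_finite_induct)
  case (insert i I)
  then show ?case by (simp add: bounded_plus_comp)
qed (auto simp: image_constant_conv)

section \<open>Positivity for linear equations\<close>

text \<open>If \<open>M\<close> bounds the absolute value of \<open>h\<close>, then
  \<open>w = y^2 * exp (2 * M * t)\<close> has derivative \<open>2 * (h + M) * w \<ge> 0\<close>. So
  \<open>w\<close> stays above its positive initial value, \<open>y\<close> has no zero, and the
  intermediate value theorem preserves its sign.\<close>

lemma linear_ode_pos:
  fixes y :: "real \<Rightarrow> real"
  assumes "a \<le> b" "finite S" "continuous_on {a..b} y"
    and der: "\<And>t. t \<in> {a<..<b} - S \<Longrightarrow> (y has_real_derivative h t * y t) (at t)"
    and h: "bounded (h ` {a<..<b})"
    and "y a > 0"
  shows "y b > 0"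
proof -
  obtain M where M: "\<And>t. t \<in> {a<..<b} \<Longrightarrow> \<bar>h t\<bar> \<le> M"
    using h unfolding bounded_real by (metis imageI)
  define w where "w t = (y t)\<^sup>2 * exp (2 * M * t)" for t
  have w: "0 < w c" if "c \<in> {a..b}" for c
  proof -
    \<comment> \<open>The value 0 outside the open interval makes \<open>w'\<close> nonnegative
      everywhere, as the bound \<open>M\<close> holds only inside.\<close>
    define w' where
      "w' t = (if t \<in> {a<..<c} then 2 * (h t + M) * ((y t)\<^sup>2 * exp (2 * M * t)) else 0)" for t
    have "(w' has_integral w c - w a) {a..c}"
    proof (rule fundamental_theorem_of_calculus_interior_strong[OF \<open>finite S\<close>])
      show "a \<le> c" using that by simp
      show "continuous_on {a..c} w"
        unfolding w_def using that
        by (intro continuous_intros continuous_on_subset[OF assms(3)]) auto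
      show "(w has_vector_derivative w' t) (at t)" if t: "t \<in> {a<..<c} - S" for t
      proof -
        have "(y has_real_derivative h t * y t) (at t)"
          using t \<open>c \<in> {a..b}\<close> by (intro der) auto
        then have "(w has_real_derivative 2 * (h t + M) * ((y t)\<^sup>2 * exp (2 * M * t))) (at t)"
          unfolding w_def
          by (auto intro!: derivative_eq_intros simp: algebra_simps power2_eq_square)
        then show ?thesis
          using t by (simp add: w'_def has_real_derivative_iff_has_vector_derivative)
      qed
    qed
    moreover have "0 \<le> w' t" for t
      using M[of t] that by (auto simp: w'_def abs_le_iff)
    ultimately have "w a \<le> w c"
      using has_integral_nonneg[of w' "w c - w a" "{a..c}"] by simp
    moreover have "0 < w a" using \<open>y a > 0\<close> by (simp add: w_def)
    ultimately show ?thesis by simp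
  qed
  show ?thesis
  proof (rule ccontr)
    assume "\<not> y b > 0"
    then obtain c where "a \<le> c" "c \<le> b" "y c = 0"
      using IVT2'[of y b 0 a] assms by auto
    with w[of c] show False by (simp add: w_def)
  qed
qed

section \<open>The vector fields\<close>

locale control_n_body =
  fixes \<epsilon> :: real and n m :: nat and idx :: "nat \<Rightarrow> 'n::finite"
  assumes idx: "bij_betw idx {1..n} (UNIV :: 'n set)"
    and m_le: "m \<le> n" and m_ge: "n + 1 \<le> 2 * m"
begin

definition step :: "nat \<Rightarrow> real^'n" where
  "step k = (\<chi> i. if i \<in> idx ` {k..n} then 1 else 0)"

definition gap :: "nat \<Rightarrow> real^'n \<Rightarrow> real" where
  "gap j x = x $ idx (j + 1) - x $ idx j - \<epsilon>"

text \<open>If \<open>m + l - 1 > n\<close>, the second term vanishes because \<open>step\<close> is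
  then 0, so its gap, which refers to an index beyond \<open>n\<close>, does no harm.\<close>

definition field :: "nat \<Rightarrow> real^'n \<Rightarrow> real^'n" where
  "field l x = (if l = 1 then step 1 else
     (x $ idx (l - 1) * gap (l - 1) x) *\<^sub>R step l +
     ((1 - x $ idx (l - 1)) * gap (m + l - 2) x) *\<^sub>R step (m + l - 1))"

section \<open>Gap coordinates and elementary properties of the fields\<close>

lemma step_nth:
  assumes "1 \<le> k" "j \<in> {1..n}"
  shows "step k $ idx j = (if k \<le> j then 1 else 0)"
proof -
  have "idx j \<in> idx ` {k..n} \<longleftrightarrow> k \<le> j"
    using inj_on_image_mem_iff[OF bij_betw_imp_inj_on[OF idx], of j "{k..n}"] assms by auto
  then show ?thesis by (simp add: step_def)
qed

text \<open>Both ends of the gap move together, or neither moves, unless the step begins exactly at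
  its right end.\<close>

lemma gap_add_step:
  assumes "1 \<le> k" "j \<in> {1..n - 1}"
  shows "gap j (x + s *\<^sub>R step k) = gap j x + (if k = j + 1 then s else 0)"
proof -
  have "step k $ idx (j + 1) = (if k \<le> j + 1 then 1 else 0)"
    "step k $ idx j = (if k \<le> j then 1 else 0)"
    using assms by (intro step_nth; force)+
  then show ?thesis by (auto simp: gap_def)
qed

lemma separated_by_iff_gap: "separated_by \<epsilon> n idx x \<longleftrightarrow> (\<forall>j\<in>{1..n-1}. 0 < gap j x)"
  by (auto simp: separated_by_def gap_def algebra_simps)

lemma eq_if_gaps_eq:
  assumes "x $ idx 1 = y $ idx 1" "\<And>j. j \<in> {1..n-1} \<Longrightarrow> gap j x = gap j y"
  shows "x = y"
proof -
  have "x $ idx j = y $ idx j" if "1 \<le> j" "j \<le> n" for j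
    using that
  proof (induction j rule: nat_induct_at_least)
    case base
    show ?case by (fact assms(1))
  next
    case (Suc j)
    then show ?case using assms(2)[of j] by (auto simp: gap_def)
  qed
  then have "x $ i = y $ i" for i
    using bij_betw_imp_surj_on[OF idx] by (metis UNIV_I atLeastAtMost_iff imageE)
  then show ?thesis by (simp add: vec_eq_iff)
qed

lemma smooth_field: "smooth (field l)"
proof -
  have nth: "smooth (\<lambda>x::real^'n. x $ i)" for i
    by (rule smooth_bounded_linear) (rule bounded_linear_vec_nth)
  show ?thesis
    unfolding field_def gap_def
    by (cases "l = 1")
      (auto intro!: smooth_const smooth_add smooth_diff smooth_mult smooth_scaleR nth)
qed

lemma depends_only_on_field:
  assumes "l \<in> {1..m}"
  shows "depends_only_on n idx {l - 1, l, m + l - 2, m + l - 1} (field l)"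
  unfolding depends_only_on_def
proof (intro allI impI)
  fix x y :: "real^'n"
  assume eq: "\<forall>k\<in>{l - 1, l, m + l - 2, m + l - 1} \<inter> {1..n}. x $ idx k = y $ idx k"
  show "field l x = field l y"
  proof (cases "l = 1")
    case False
    have m1: "2 \<le> l" "1 \<le> m" using False assms by auto
    then have "l - 1 \<in> {1..n}" "l \<in> {1..n}"
      using assms m_le by (simp_all, linarith+)
    then have 1: "x $ idx (l - 1) = y $ idx (l - 1)" "x $ idx l = y $ idx l"
      using eq by blast+
    then have 2: "gap (l - 1) x = gap (l - 1) y"
      using m1 by (simp add: gap_def)
    show ?thesis
    proof (cases "m + l - 1 \<le> n")
      case True
      then have "m + l - 1 \<in> {1..n}" "m + l - 2 \<in> {1..n}"
        using m1 by (simp_all, linarith+)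
      then have "x $ idx (m + l - 1) = y $ idx (m + l - 1)"
        "x $ idx (m + l - 2) = y $ idx (m + l - 2)"
        using eq by blast+
      moreover have "m + l - 2 + 1 = m + l - 1" using m1 by simp
      ultimately have "gap (m + l - 2) x = gap (m + l - 2) y"
        by (simp add: gap_def)
      then show ?thesis using 1 2 by (simp add: field_def)
    next
      case False
      then have "step (m + l - 1) = 0" by (simp add: step_def vec_eq_iff)
      then show ?thesis using 1 2 by (simp add: field_def)
    qed
  qed (simp add: field_def)
qed

subsection \<open>Absence of collisions\<close>

text \<open>Where \<open>gap j\<close> is nonzero, this is its logarithmic derivative along
  \<open>field l\<close>; translation contributes 0.\<close>

definition rate :: "nat \<Rightarrow> nat \<Rightarrow> real^'n \<Rightarrow> real" where
  "rate j l x = (if l = 1 then 0 else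
     (if l = j + 1 then x $ idx (l - 1) else 0) +
     (if m + l - 1 = j + 1 then 1 - x $ idx (l - 1) else 0))"

text \<open>The reason collisions are impossible: every term of a field that changes a gap carries
  that same gap as a factor.\<close>

lemma field_diff:
  assumes "l \<in> {1..m}" "j \<in> {1..n - 1}"
  shows "field l x $ idx (j + 1) - field l x $ idx j = rate j l x * gap j x"
proof -
  have st: "step k $ idx (j + 1) - step k $ idx j = (if k = j + 1 then 1 else 0)" if "1 \<le> k" for k
    using gap_add_step[OF that assms(2), of 0 1] by (simp add: gap_def split: if_splits)
  show ?thesis
  proof (cases "l = 1")
    case True
    then show ?thesis using st[of 1] assms by (simp add: field_def rate_def)
  next
    case False
    let ?A = "x $ idx (l - 1) * gap (l - 1) x"
    let ?B = "(1 - x $ idx (l - 1)) * gap (m + l - 2) x"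
    have "field l x $ idx (j + 1) - field l x $ idx j =
        ?A * (step l $ idx (j + 1) - step l $ idx j) +
        ?B * (step (m + l - 1) $ idx (j + 1) - step (m + l - 1) $ idx j)"
      using False by (simp add: field_def algebra_simps)
    also have "\<dots> = ?A * (if l = j + 1 then 1 else 0) + ?B * (if m + l - 1 = j + 1 then 1 else 0)"
    proof -
      have "1 \<le> l" "1 \<le> m + l - 1" using assms by (simp, simp, linarith)
      then show ?thesis by (simp only: st)
    qed
    also have "\<dots> = rate j l x * gap j x"
    proof -
      have "m + l - 1 = j + 1 \<Longrightarrow> m + l - 2 = j" by simp
      then show ?thesis using False by (simp add: rate_def distrib_right)
    qed
    finally show ?thesis .
  qed
qed

text \<open>Each gap solves \<open>y' = h * y\<close>, where \<open>h\<close> is the sum of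
  \<open>u l * rate j l\<close>. It is bounded because the controls are, and because
  \<open>rate\<close> is continuous along the trajectory on the compact
  \<open>{0..T}\<close>.\<close>

lemma collision_free_field: "collision_free \<epsilon> n idx m field"
  unfolding collision_free_def
proof (intro allI impI ballI, elim conjE)
  fix J u and x :: "real \<Rightarrow> real^'n" and T
  assume J: "is_interval J" "0 \<in> J" "J \<subseteq> {0..}"
    and u: "\<forall>l\<in>{1..m}. piecewise_smooth_on J (u l)"
    and sol: "control_solution_on J m field u x"
    and sep: "separated_by \<epsilon> n idx (x 0)" and T: "T \<in> J"
  have T0: "0 \<le> T" using T J by auto
  have sub: "{0..T} \<subseteq> J"
    using mem_is_interval_1_I[OF J(1,2) T] by auto
  have contx: "continuous_on {0..T} x"
    using sol sub by (auto simp: control_solution_on_def intro: continuous_on_subset)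
  obtain S where S: "finite S" "\<And>t. t \<in> J - S \<Longrightarrow>
      (x has_vector_derivative (\<Sum>l\<in>{1..m}. u l t *\<^sub>R field l (x t))) (at t within J)"
    using sol unfolding control_solution_on_def by blast
  have "0 < gap j (x T)" if j: "j \<in> {1..n-1}" for j
  proof (rule linear_ode_pos[OF T0 S(1)])
    show "continuous_on {0..T} (\<lambda>t. gap j (x t))"
      unfolding gap_def by (intro continuous_intros contx)
    show "0 < gap j (x 0)"
      using sep j by (simp add: separated_by_iff_gap)
    let ?h = "\<lambda>t. \<Sum>l\<in>{1..m}. u l t * rate j l (x t)"
    show "bounded (?h ` {0<..<T})"
    proof -
      have "bounded ((\<lambda>t. u l t * rate j l (x t)) ` {0<..<T})" if "l \<in> {1..m}" for l
      proof -
        have "continuous_on {0..T} (\<lambda>t. rate j l (x t))"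
          unfolding rate_def
          by (cases "l = 1"; cases "l = j + 1"; cases "m + l - 1 = j + 1")
            (simp_all only: if_True if_False, auto intro!: continuous_intros contx)
        then have "bounded ((\<lambda>t. rate j l (x t)) ` {0..T})"
          by (simp add: compact_continuous_image compact_imp_bounded)
        then have "bounded ((\<lambda>t. rate j l (x t)) ` {0<..<T})"
          by (rule bounded_subset) auto
        moreover have "bounded (u l ` {0<..<T})"
          using piecewise_smooth_on_bounded u that sub by blast
        ultimately show ?thesis
          by (rule bounded_image_mult[rotated])
      qed
      then show ?thesis by (intro bounded_image_sum)
    qed
    show "((\<lambda>t. gap j (x t)) has_real_derivative ?h t * gap j (x t)) (at t)"
      if t: "t \<in> {0<..<T} - S" for t
    proof -
      let ?D = "\<Sum>l\<in>{1..m}. u l t *\<^sub>R field l (x t)"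
      \<comment> \<open>Restricting from \<open>J\<close> to an open interval turns the relative
        derivative into a two-sided one.\<close>
      have "(x has_vector_derivative ?D) (at t within {0<..<T})"
      proof (rule has_vector_derivative_within_subset[OF S(2)])
        have "{0<..<T} \<subseteq> {0..T}" by auto
        with sub show "{0<..<T} \<subseteq> J" by (rule subset_trans[rotated])
        with t show "t \<in> J - S" by blast
      qed
      then have "(x has_vector_derivative ?D) (at t)"
        using t by (simp only: at_within_open[of t "{0<..<T}"] open_greaterThanLessThan Diff_iff)
      then have "((\<lambda>s. x s $ i) has_vector_derivative ?D $ i) (at t)" for i
        by (rule bounded_linear.has_vector_derivative[OF bounded_linear_vec_nth])
      then have "((\<lambda>s. x s $ i) has_real_derivative ?D $ i) (at t)" for i
        by (simp add: has_real_derivative_iff_has_vector_derivative)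
      then have "((\<lambda>t. gap j (x t)) has_real_derivative ?D $ idx (j + 1) - ?D $ idx j) (at t)"
        unfolding gap_def by (auto intro!: derivative_eq_intros)
      also have "?D $ idx (j + 1) - ?D $ idx j =
          (\<Sum>l\<in>{1..m}. u l t * (field l (x t) $ idx (j + 1) - field l (x t) $ idx j))"
        by (simp add: sum_subtractf right_diff_distrib)
      also have "\<dots> = (\<Sum>l\<in>{1..m}. u l t * rate j l (x t) * gap j (x t))"
        using j by (intro sum.cong refl) (simp only: field_diff mult.assoc)
      also have "\<dots> = ?h t * gap j (x t)"
        by (simp add: sum_distrib_right)
      finally show ?thesis .
    qed
  qed
  then show "separated_by \<epsilon> n idx (x T)"
    by (simp add: separated_by_iff_gap)
qed

subsection \<open>Controllability\<close>

lemma m_pos: "1 \<le> m"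
  using m_ge by simp

lemma reachable_translate: "reachable m field p (p + c *\<^sub>R step 1)"
proof -
  have "reachable m field (p + (c * 0) *\<^sub>R step 1) (p + (c * 1) *\<^sub>R step 1)"
    by (rule reachable_along_line[of 1 m "\<lambda>t. c * t" "\<lambda>t. c" _ c])
      (use m_pos in \<open>auto intro!: derivative_eq_intros simp: field_def\<close>)
  then show ?thesis by simp
qed

text \<open>The value 1 or 0 of coordinate \<open>l - 1\<close> switches off one of the two terms.
  Since \<open>l - 1 \<le> k\<close>, moving along \<open>step (k + 1)\<close> keeps that coordinate
  fixed, so the simplified form persists.\<close>

lemma field_eq_gap_step:
  assumes "k \<in> {1..n - 1}"
  obtains l s where "l \<in> {2..m}" "l - 1 \<le> k"
    "\<And>x. x $ idx (l - 1) = s \<Longrightarrow> field l x = gap k x *\<^sub>R step (k + 1)"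
proof (cases "k < m")
  case True
  show ?thesis
  proof (rule that[of "k + 1" 1])
    show "field (k + 1) x = gap k x *\<^sub>R step (k + 1)" if "x $ idx (k + 1 - 1) = 1" for x
      using that assms by (simp add: field_def)
  qed (use True assms in auto)
next
  case False
  \<comment> \<open>The solution of \<open>m + l - 2 = k\<close>. Here \<open>l \<le> m\<close>
    holds because \<open>k + 2 \<le> n + 1 \<le> 2 * m\<close>; this is where the lower bound on
    \<open>m\<close> enters.\<close>
  define l where "l = k - m + 2"
  have l: "l \<in> {2..m}" "l - 1 \<le> k" "m + l - 2 = k" "m + l - 1 = k + 1" "l \<noteq> 1"
    using False assms m_ge m_pos by (auto simp: l_def)
  show ?thesis
  proof (rule that[OF l(1,2), of 0])
    show "field l x = gap k x *\<^sub>R step (k + 1)" if "x $ idx (l - 1) = 0" for x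
      using that l by (simp add: field_def)
  qed
qed

text \<open>A translation to \<open>r\<close> brings coordinate \<open>l - 1\<close> to
  \<open>s\<close>; from there \<open>field l\<close> moves along a line on which gap
  \<open>k\<close> evolves exponentially and the other gaps stay fixed.\<close>

lemma reachable_set_gap:
  assumes k: "k \<in> {1..n - 1}" and pos: "0 < gap k p" "0 < g"
  obtains p' where "reachable m field p p'"
    "\<And>j. j \<in> {1..n - 1} \<Longrightarrow> gap j p' = (if j = k then g else gap j p)"
proof -
  obtain l s where l: "l \<in> {2..m}" "l - 1 \<le> k"
    and fl: "\<And>x. x $ idx (l - 1) = s \<Longrightarrow> field l x = gap k x *\<^sub>R step (k + 1)"
    using field_eq_gap_step[OF k] by metis
  have li: "l - 1 \<in> {1..n}" using l m_le by auto
  define r where "r = p + (s - p $ idx (l - 1)) *\<^sub>R step 1"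
  have gr: "gap j r = gap j p" if "j \<in> {1..n - 1}" for j
    using gap_add_step[OF _ that, of 1] that by (simp add: r_def)
  have "r $ idx (l - 1) = s"
    using step_nth[of 1 "l - 1"] li by (simp add: r_def)
  moreover have "step (k + 1) $ idx (l - 1) = 0"
    using step_nth[of "k + 1" "l - 1"] li l by simp
  ultimately have "field l (r + c *\<^sub>R step (k + 1)) = (gap k p + c) *\<^sub>R step (k + 1)" for c
    using gap_add_step[of "k + 1" k r c] k gr by (subst fl) auto
  note field = this
  \<comment> \<open>Growth at rate \<open>a\<close> for unit time multiplies the gap by
    \<open>exp a = g / gap k p\<close>; \<open>?s\<close> is the resulting change of the
    gap.\<close>
  define a where "a = ln (g / gap k p)"
  let ?s = "\<lambda>t. gap k p * (exp (a * t) - 1)"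
  have "reachable m field (r + ?s 0 *\<^sub>R step (k + 1)) (r + ?s 1 *\<^sub>R step (k + 1))"
  proof (rule reachable_along_line[of l _ _ "\<lambda>t. gap k p * (a * exp (a * t))" _ a])
    show "l \<in> {1..m}" using l by auto
    show "(?s has_real_derivative gap k p * (a * exp (a * t))) (at t)" for t
      by (auto intro!: derivative_eq_intros)
    show "(gap k p * (a * exp (a * t))) *\<^sub>R step (k + 1) = a *\<^sub>R field l (r + ?s t *\<^sub>R step (k + 1))" for t
      by (simp only: field) (simp add: algebra_simps)
  qed
  moreover have "?s 1 = g - gap k p"
    using pos by (simp add: a_def field_simps)
  ultimately have "reachable m field r (r + (g - gap k p) *\<^sub>R step (k + 1))"
    by simp
  then have "reachable m field p (r + (g - gap k p) *\<^sub>R step (k + 1))"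
    using reachable_trans reachable_translate r_def by metis
  moreover have "gap j (r + (g - gap k p) *\<^sub>R step (k + 1)) = (if j = k then g else gap j p)"
    if "j \<in> {1..n - 1}" for j
    using gap_add_step[OF _ that, of "k + 1"] gr[OF that] by simp
  ultimately show ?thesis by (rule that)
qed

text \<open>Gaps are corrected from left to right. Those not yet treated keep their positive values
  from \<open>p\<close>, so \<open>reachable_set_gap\<close> stays applicable.\<close>

lemma reachable_set_gaps:
  assumes "separated_by \<epsilon> n idx p" "separated_by \<epsilon> n idx q" "k \<le> n - 1"
  shows "\<exists>p'. reachable m field p p' \<and>
    (\<forall>j\<in>{1..n - 1}. gap j p' = (if j \<le> k then gap j q else gap j p))"
  using assms(3)
proof (induction k)
  case 0
  show ?case
    \<comment> \<open>Translation by 0 shows that \<open>p\<close> is reachable from itself.\<close>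
    using reachable_translate[of p 0] by (intro exI[of _ p]) auto
next
  case (Suc k)
  then obtain p' where p': "reachable m field p p'"
    "\<And>j. j \<in> {1..n - 1} \<Longrightarrow> gap j p' = (if j \<le> k then gap j q else gap j p)"
    by auto
  have k: "Suc k \<in> {1..n - 1}" using Suc.prems by simp
  have "0 < gap (Suc k) p'" "0 < gap (Suc k) q"
    using p'(2)[OF k] assms k by (auto simp: separated_by_iff_gap)
  then obtain p'' where "reachable m field p' p''"
    "\<And>j. j \<in> {1..n - 1} \<Longrightarrow> gap j p'' = (if j = Suc k then gap (Suc k) q else gap j p')"
    using reachable_set_gap[OF k] by metis
  then show ?case
    using p' reachable_trans by (intro exI[of _ p'']) (auto simp: le_Suc_eq)
qed

lemma reachable_separated:
  assumes "separated_by \<epsilon> n idx p" "separated_by \<epsilon> n idx q"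
  shows "reachable m field p q"
proof -
  obtain p' where p': "reachable m field p p'" "\<And>j. j \<in> {1..n - 1} \<Longrightarrow> gap j p' = gap j q"
    using reachable_set_gaps[OF assms order_refl] by auto
  have "p' + (q $ idx 1 - p' $ idx 1) *\<^sub>R step 1 = q"
  proof (rule eq_if_gaps_eq)
    show "(p' + (q $ idx 1 - p' $ idx 1) *\<^sub>R step 1) $ idx 1 = q $ idx 1"
      using step_nth[of 1 1] m_pos m_le by simp
    show "gap j (p' + (q $ idx 1 - p' $ idx 1) *\<^sub>R step 1) = gap j q" if "j \<in> {1..n - 1}" for j
      using gap_add_step[OF _ that, of 1] p'(2)[OF that] that by simp
  qed
  then show ?thesis
    using reachable_trans[OF p'(1) reachable_translate] by metis
qed

lemma controllable_field: "controllable \<epsilon> n idx m field"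
  \<comment> \<open>The free starting time is set to 0.\<close>
  unfolding controllable_def using reachable_separated unfolding reachable_def by blast

end

theorem corollary1p3:
  fixes \<epsilon> :: real and n m :: nat and idx :: "nat \<Rightarrow> 'n::finite"
  assumes "\<epsilon> > 0" and "n \<ge> 2"
    and "bij_betw idx {1..n} (UNIV :: 'n set)"
    and "m \<le> n" and "2 * m \<ge> n + 1"
  shows "\<exists>f :: nat \<Rightarrow> real^'n \<Rightarrow> real^'n.
    solves_control_n_body \<epsilon> n idx m f \<and>
    (\<forall>l\<in>{1..m}. depends_only_on n idx {l - 1, l, m + l - 2, m + l - 1} (f l))"
proof -
  interpret control_n_body \<epsilon> n m idx
    by unfold_locales (use assms in auto)
  show ?thesis
    using smooth_field collision_free_field controllable_field depends_only_on_field
    unfolding solves_control_n_body_def by blast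
qed

end
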